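(* There exist a doubling metric measure space $(X,d,\mu)$ and a function $f\in L^\infty_w(X)$ such that no function $g$ defined on $X$ and equimeasurable to $f$ belongs to $BMO(X)$.
   Context: A doubling metric measure space is a metric space $(X,d)$ with a Borel regular measure $\mu$ such that all open balls have positive and finite measure and there is $c_\mu\geq 1$ with $\mu(B(x,2r))\leq c_\mu\mu(B(x,r))$ for all $x\in X$, $r>0$, where $B(x,r)=\{y\in X:d(y,x)<r\}$. For a measurable $f:X\to\mathbb{R}$: $d_{f,\mu}(\lambda)=\mu(\{x\in X:|f(x)|>\lambda\})$ for $\lambda\geq 0$; $f^*(t)=\inf\{\lambda\geq0: d_{f,\mu}(\lambda)\leq t\}$ for $t>0$ (with $\inf\emptyset=\infty$); $f^{**}(t)=\frac1t\int_0^t f^*(s)\,ds$. The space $L^\infty_w(X)$ (weak $L^\infty$) is the collection of all $f$ such that $f^*$ is finite everywhere on $(0,\infty)$ and $\sup_{t>0}(f^{**}(t)-f^*(t))<\infty$. Functions $f,g$ on $X$ are equimeasurable if $d_{f,\mu}=d_{g,\mu}$. A function $g:X\to\mathbb{R}$ that is integrable over every ball belongs to $BMO(X)$ if there is $M\geq 0$ with $\frac1{\mu(B)}\int_B|g-g_B|\,d\mu\leq M$ for every ball $B\subset X$, where $g_B=\frac1{\mu(B)}\int_B g\,d\mu$. *)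

theory Defs
  imports "HOL-Analysis.Analysis"
begin

text \<open>
  Spaces are given by a carrier set, since the results quantify over the space itself. The carrier
  type is not a restriction when it is instantiated to \<^typ>\<open>real\<close>: a metric space with a doubling
  measure is separable, hence has at most continuum many points, and so it is isometric to some
  \<open>(X, d)\<close> with \<open>X\<close> a set of reals and \<open>d\<close> an arbitrary metric on \<open>X\<close>, unrelated to the usual
  distance of reals. Functions on the space are total HOL functions of which only the values on
  the carrier matter.
\<close>

text \<open>
  In \<open>borel_regular\<close> it suffices to consider measurable \<open>A\<close>; the property then extends to all
  subsets of \<open>X\<close> for the outer measure induced by \<open>\<mu>\<close>.
\<close>

locale doubling_metric_measure_space = Metric_space X d
  for X :: "'a set" and d :: "'a \<Rightarrow> 'a \<Rightarrow> real" +
  fixes \<mu> :: "'a measure"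
  assumes space_eq: "space \<mu> = X"
    and borel_sets: "sigma_sets X {U. openin mtopology U} \<subseteq> sets \<mu>"
    and borel_regular:
      "\<And>A. A \<in> sets \<mu> \<Longrightarrow>
        \<exists>B \<in> sigma_sets X {U. openin mtopology U}. A \<subseteq> B \<and> emeasure \<mu> B = emeasure \<mu> A"
    and ball_pos: "\<And>x r. x \<in> X \<Longrightarrow> 0 < r \<Longrightarrow> 0 < emeasure \<mu> (mball x r)"
    and ball_finite: "\<And>x r. x \<in> X \<Longrightarrow> 0 < r \<Longrightarrow> emeasure \<mu> (mball x r) < \<infinity>"
    and doubling:
      "\<exists>c::real. 1 \<le> c \<and>
        (\<forall>x\<in>X. \<forall>r>0. emeasure \<mu> (mball x (2 * r)) \<le> ennreal c * emeasure \<mu> (mball x r))"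

definition distribution_fun :: "'a measure \<Rightarrow> ('a \<Rightarrow> real) \<Rightarrow> real \<Rightarrow> ennreal" where
  "distribution_fun \<mu> f l = emeasure \<mu> {x \<in> space \<mu>. \<bar>f x\<bar> > l}"

text \<open>The infimum is taken in \<^typ>\<open>ennreal\<close>, so that the infimum of the empty set is \<open>\<infinity>\<close>.\<close>

definition decr_rearrangement :: "'a measure \<Rightarrow> ('a \<Rightarrow> real) \<Rightarrow> real \<Rightarrow> ennreal" where
  "decr_rearrangement \<mu> f t =
    Inf {ennreal l | l. 0 \<le> l \<and> distribution_fun \<mu> f l \<le> ennreal t}"

definition maximal_rearrangement :: "'a measure \<Rightarrow> ('a \<Rightarrow> real) \<Rightarrow> real \<Rightarrow> ennreal" where
  "maximal_rearrangement \<mu> f t =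
    (\<integral>\<^sup>+s\<in>{0<..<t}. decr_rearrangement \<mu> f s \<partial>lborel) / ennreal t"

text \<open>
  The truncated subtraction of \<^typ>\<open>ennreal\<close> is harmless here: \<open>f\<^sup>*\<close> is finite and nonincreasing,
  so \<open>f\<^sup>*(t) \<le> f\<^sup>*\<^sup>*(t)\<close>, and the difference is \<open>\<infinity>\<close> if \<open>f\<^sup>*\<^sup>*(t)\<close> is.
\<close>

definition weak_Linfty :: "'a measure \<Rightarrow> ('a \<Rightarrow> real) set" where
  "weak_Linfty \<mu> = {f \<in> borel_measurable \<mu>.
    (\<forall>t>0. decr_rearrangement \<mu> f t < \<infinity>) \<and>
    (SUP t\<in>{0<..}. maximal_rearrangement \<mu> f t - decr_rearrangement \<mu> f t) < \<infinity>}"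

definition equimeasurable :: "'a measure \<Rightarrow> ('a \<Rightarrow> real) \<Rightarrow> ('a \<Rightarrow> real) \<Rightarrow> bool" where
  "equimeasurable \<mu> f g \<longleftrightarrow> f \<in> borel_measurable \<mu> \<and> g \<in> borel_measurable \<mu> \<and>
    (\<forall>l\<ge>0. distribution_fun \<mu> f l = distribution_fun \<mu> g l)"

definition set_average :: "'a measure \<Rightarrow> 'a set \<Rightarrow> ('a \<Rightarrow> real) \<Rightarrow> real" where
  "set_average \<mu> B g = (1 / measure \<mu> B) * (LINT x:B|\<mu>. g x)"

definition BMO :: "'a set \<Rightarrow> ('a \<Rightarrow> 'a \<Rightarrow> real) \<Rightarrow> 'a measure \<Rightarrow> ('a \<Rightarrow> real) set" where
  "BMO X d \<mu> = {g.
    (\<forall>x\<in>X. \<forall>r>0. set_integrable \<mu> (Metric_space.mball X d x r) g) \<and>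
    (\<exists>M\<ge>0. \<forall>x\<in>X. \<forall>r>0. let B = Metric_space.mball X d x r in
      set_average \<mu> B (\<lambda>y. \<bar>g y - set_average \<mu> B g\<bar>) \<le> M)}"

end

theory Submission
  imports Defs
begin

text \<open>
  Let \<open>X\<close> be the set of natural numbers, where \<open>n\<close> has mass \<open>3\<^sup>-\<^sup>n\<close> and distinct points \<open>m\<close>, \<open>n\<close>
  are at distance \<open>max (3\<^sup>-\<^sup>m) (3\<^sup>-\<^sup>n)\<close>. Since \<open>3\<^sup>-\<^sup>n\<close> exceeds the total mass of all larger numbers,
  a subset of \<open>X\<close> is determined by its mass, so a function \<open>g\<close> equimeasurable to \<open>f\<close> satisfies
  \<open>\<bar>g\<bar> = \<bar>f\<bar>\<close>. Take \<open>f n = n\<close> for even \<open>n\<close> and \<open>f n = 0\<close> for odd \<open>n\<close>. The distribution function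
  of \<open>f\<close> decays exponentially, so \<open>f\<close> belongs to weak \<open>L\<^sup>\<infinity>\<close>. But a ball \<open>{n, n + 1, \<dots>}\<close> with \<open>n\<close>
  even is made up, to a fixed proportion, of the points \<open>n\<close> and \<open>n + 1\<close>, on which \<open>\<bar>g\<bar>\<close> is \<open>n\<close>
  and \<open>0\<close>, so the mean oscillation of \<open>g\<close> is unbounded.
\<close>

section \<open>Naturals with geometric masses\<close>

text \<open>The points are reals, so the exponent is real; \<open>powr\<close> keeps the weight
  positive at every real, and the metric axioms then hold without membership in
  \<open>\<nat>\<close>.\<close>

definition geo_weight :: "real \<Rightarrow> real" where
  "geo_weight x = (1/3) powr x"

text \<open>The maximum makes every ball either a single point or a tail {n, n + 1, ...}.\<close>

definition geo_dist :: "real \<Rightarrow> real \<Rightarrow> real" where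
  "geo_dist x y = (if x = y then 0 else max (geo_weight x) (geo_weight y))"

definition geo_measure :: "real measure" where
  "geo_measure = density (count_space \<nat>) (\<lambda>x. ennreal (geo_weight x))"

definition even_part :: "real \<Rightarrow> real" where
  "even_part x = (if even \<lfloor>x\<rfloor> then x else 0)"

lemma geo_weight_of_nat [simp]: "geo_weight (real n) = (1/3) ^ n"
  by (simp add: geo_weight_def powr_realpow)

lemma geo_weight_pos: "0 < geo_weight x"
  by (simp add: geo_weight_def)

lemma space_geo_measure [simp]: "space geo_measure = \<nat>"
  and sets_geo_measure [simp]: "sets geo_measure = Pow \<nat>"
  by (simp_all add: geo_measure_def)

lemma borel_measurable_geo_measure: "(f :: real \<Rightarrow> real) \<in> borel_measurable geo_measure"
  by (rule measurableI) auto

lemma emeasure_geo_singleton: "emeasure geo_measure {real n} = ennreal ((1/3) ^ n)"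
proof -
  have "emeasure geo_measure {real n} =
      (\<integral>\<^sup>+x. ennreal (geo_weight x) * indicator {real n} x \<partial>count_space \<nat>)"
    unfolding geo_measure_def by (rule emeasure_density) auto
  also have "\<dots> = ennreal (geo_weight (real n)) * emeasure (count_space \<nat>) {real n}"
    by (subst nn_integral_indicator_singleton) auto
  finally show ?thesis by simp
qed

lemma emeasure_geo_atLeast:
  "emeasure geo_measure {y \<in> \<nat>. real n \<le> y} = ennreal (3/2 * (1/3) ^ n)"
proof -
  have eq: "{y \<in> \<nat>. real n \<le> y} = (\<Union>i. {real (n + i)})"
    by (auto elim!: Nats_cases simp: nat_le_iff_add)
  have "(\<Sum>i. emeasure geo_measure {real (n + i)}) = emeasure geo_measure (\<Union>i. {real (n + i)})"
    by (rule suminf_emeasure) (auto simp: disjoint_family_on_def)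
  moreover have "(\<lambda>i. (1/3) ^ n * (1/3) ^ i :: real) sums ((1/3) ^ n * (1 / (1 - 1/3)))"
    by (intro sums_mult geometric_sums) simp
  hence "(\<Sum>i. ennreal ((1/3) ^ (n + i))) = ennreal (3/2 * (1/3) ^ n)"
    by (intro suminf_ennreal_eq) (auto simp: power_add mult.commute)
  ultimately show ?thesis
    by (simp only: eq emeasure_geo_singleton)
qed

interpretation geo: finite_measure geo_measure
proof
  have "space geo_measure = {y \<in> \<nat>. real 0 \<le> y}"
    by (auto elim: Nats_cases)
  then show "emeasure geo_measure (space geo_measure) \<noteq> \<infinity>"
    by (simp only: emeasure_geo_atLeast) simp
qed

lemma measure_geo_singleton: "measure geo_measure {real n} = (1/3) ^ n"
  by (simp add: measure_def emeasure_geo_singleton)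

lemma measure_geo_atLeast: "measure geo_measure {y \<in> \<nat>. real n \<le> y} = 3/2 * (1/3) ^ n"
  by (simp only: measure_def emeasure_geo_atLeast) simp

section \<open>Sets are determined by their masses\<close>

text \<open>The first difference decides: beyond the common part below n, T has only points after n,
  and together they weigh less than the point n alone.\<close>

lemma measure_geo_less_lexicographic:
  assumes "S \<subseteq> \<nat>" "T \<subseteq> \<nat>" "real n \<in> S" "real n \<notin> T"
    and below: "\<And>m. m < n \<Longrightarrow> real m \<in> T \<longleftrightarrow> real m \<in> S"
  shows "measure geo_measure T < measure geo_measure S"
proof -
  define C where "C = {x \<in> S. x < real n}"
  have C: "C \<subseteq> \<nat>" using assms by (auto simp: C_def)
  have "T \<subseteq> C \<union> {y \<in> \<nat>. real (Suc n) \<le> y}"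
  proof
    fix x assume "x \<in> T"
    then have "x \<in> \<nat>" using assms(2) by blast
    then obtain m where m: "x = real m" by (rule Nats_cases)
    then have "m \<noteq> n" using \<open>x \<in> T\<close> assms by auto
    then show "x \<in> C \<union> {y \<in> \<nat>. real (Suc n) \<le> y}"
      using below[of m] \<open>x \<in> T\<close> m by (cases "m < n") (auto simp: C_def)
  qed
  then have "measure geo_measure T \<le> measure geo_measure (C \<union> {y \<in> \<nat>. real (Suc n) \<le> y})"
    using C by (intro geo.finite_measure_mono) auto
  also have "\<dots> \<le> measure geo_measure C + measure geo_measure {y \<in> \<nat>. real (Suc n) \<le> y}"
    using C by (intro measure_Un_le) auto
  \<comment> \<open>The tail from n + 1 has mass 3/2 * (1/3)^(n + 1), half the mass of the point
    n.\<close>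
  also have "\<dots> < measure geo_measure C + measure geo_measure {real n}"
    by (simp only: measure_geo_atLeast measure_geo_singleton) simp
  also have "\<dots> = measure geo_measure (C \<union> {real n})"
    using C by (intro geo.finite_measure_Union[symmetric]) (auto simp: C_def)
  also have "\<dots> \<le> measure geo_measure S"
    using assms by (intro geo.finite_measure_mono) (auto simp: C_def)
  finally show ?thesis .
qed

text \<open>This later turns equality of distribution functions into equality of level sets.\<close>

lemma emeasure_geo_inj:
  assumes "S \<subseteq> \<nat>" "T \<subseteq> \<nat>" "emeasure geo_measure S = emeasure geo_measure T"
  shows "S = T"
proof (rule ccontr)
  assume "S \<noteq> T"
  have "\<exists>n. (real n \<in> S) \<noteq> (real n \<in> T)"
  proof (rule ccontr)
    assume *: "\<nexists>n. (real n \<in> S) \<noteq> (real n \<in> T)"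
    have "x \<in> S \<longleftrightarrow> x \<in> T" for x
      using * assms(1,2) by (cases "x \<in> \<nat>") (auto elim!: Nats_cases)
    with \<open>S \<noteq> T\<close> show False by blast
  qed
  then obtain n where n: "(real n \<in> S) \<noteq> (real n \<in> T)"
    and below: "\<And>m. m < n \<Longrightarrow> real m \<in> S \<longleftrightarrow> real m \<in> T"
    using exists_least_iff[of "\<lambda>n. (real n \<in> S) \<noteq> (real n \<in> T)"] by blast
  have "measure geo_measure S = measure geo_measure T"
    using assms(3) by (simp add: measure_def)
  then show False
    using measure_geo_less_lexicographic[of S T n] measure_geo_less_lexicographic[of T S n]
      n below assms(1,2) by (cases "real n \<in> S") auto
qed

section \<open>Balls and the doubling condition\<close>

lemma Metric_space_geo: "Metric_space \<nat> geo_dist"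
proof
  show "0 \<le> geo_dist x y" for x y
    using geo_weight_pos[of x] by (simp add: geo_dist_def max_def)
  show "geo_dist x y = geo_dist y x" for x y
    by (simp add: geo_dist_def max.commute)
  show "geo_dist x y = 0 \<longleftrightarrow> x = y" for x y
    using geo_weight_pos[of x] geo_weight_pos[of y] by (auto simp: geo_dist_def max_def)
  show "geo_dist x z \<le> geo_dist x y + geo_dist y z" for x y z
    using geo_weight_pos[of x] geo_weight_pos[of y] geo_weight_pos[of z]
    by (auto simp: geo_dist_def max_def)
qed

text \<open>Every other point is at distance at least \<open>geo_weight x\<close> from x.\<close>

lemma mball_geo_small:
  assumes "x \<in> \<nat>" "0 < r" "r \<le> geo_weight x"
  shows "Metric_space.mball \<nat> geo_dist x r = {x}"
  using assms by (auto simp: Metric_space.in_mball[OF Metric_space_geo] geo_dist_def split: if_splits)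

lemma mball_geo_large:
  assumes "x \<in> \<nat>" "geo_weight x < r"
  shows "Metric_space.mball \<nat> geo_dist x r = {y \<in> \<nat>. geo_weight y < r}"
  using assms geo_weight_pos[of x]
  by (auto simp: Metric_space.in_mball[OF Metric_space_geo] geo_dist_def split: if_splits)

text \<open>Weights decrease along the naturals, so those below r form a tail. Minimality of its
  first point n is exported in order to compare tails for different radii.\<close>

lemma mball_geo_tail:
  assumes "x \<in> \<nat>" "geo_weight x < r"
  obtains n where "(1/3) ^ n < r" "\<And>m. (1/3) ^ m < r \<Longrightarrow> n \<le> m"
    "Metric_space.mball \<nat> geo_dist x r = {y \<in> \<nat>. real n \<le> y}"
proof -
  define n where "n = (LEAST m. (1/3 :: real) ^ m < r)"
  obtain k where "x = real k" using assms(1) by (auto elim: Nats_cases)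
  then have k: "(1/3) ^ k < r" using assms(2) by simp
  have n: "(1/3) ^ n < r" unfolding n_def using k by (rule LeastI)
  have least: "n \<le> m" if "(1/3) ^ m < r" for m
    unfolding n_def using that by (rule Least_le)
  have up: "(1/3) ^ m < r" if "n \<le> m" for m
    by (rule le_less_trans[OF power_decreasing[OF that] n]) auto
  have "Metric_space.mball \<nat> geo_dist x r = {y \<in> \<nat>. real n \<le> y}"
    unfolding mball_geo_large[OF assms] by (auto elim!: Nats_cases intro: least up)
  with n least show thesis by (rule that)
qed

lemma geo_doubling:
  assumes "x \<in> \<nat>" "0 < r"
  shows "emeasure geo_measure (Metric_space.mball \<nat> geo_dist x (2 * r))
    \<le> ennreal 3 * emeasure geo_measure (Metric_space.mball \<nat> geo_dist x r)"
proof -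
  obtain k where k: "x = real k" using assms(1) by (auto elim: Nats_cases)
  consider "2 * r \<le> geo_weight x" | "r \<le> geo_weight x" "geo_weight x < 2 * r" | "geo_weight x < r"
    by linarith
  then show ?thesis
  proof cases
    case 1
    then have "Metric_space.mball \<nat> geo_dist x (2 * r) = {x}" "Metric_space.mball \<nat> geo_dist x r = {x}"
      using assms mball_geo_small[of x "2 * r"] mball_geo_small[of x r] by auto
    then show ?thesis
      by (simp add: k emeasure_geo_singleton flip: ennreal_mult del: ennreal_numeral)
  next
    case 2
    then obtain n where n: "(1/3) ^ n < 2 * r"
      "Metric_space.mball \<nat> geo_dist x (2 * r) = {y \<in> \<nat>. real n \<le> y}"
      using mball_geo_tail[OF assms(1)] by metis
    have ball: "Metric_space.mball \<nat> geo_dist x r = {real k}"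
      using assms 2 mball_geo_small[of x r] k by simp
    \<comment> \<open>Hence the tail, of mass 3/2 * (1/3)^n, weighs less than 3 * (1/3)^k.\<close>
    have "(1/3 :: real) ^ n < 2 * (1/3) ^ k" using n(1) 2 k by simp
    then show ?thesis
      unfolding n(2) ball emeasure_geo_singleton emeasure_geo_atLeast
      by (simp flip: ennreal_mult del: ennreal_numeral)
  next
    case 3
    obtain n where n: "\<And>m. (1/3) ^ m < r \<Longrightarrow> n \<le> m"
      "Metric_space.mball \<nat> geo_dist x r = {y \<in> \<nat>. real n \<le> y}"
      using mball_geo_tail[OF assms(1) 3] by metis
    have "geo_weight x < 2 * r" using 3 assms by simp
    then obtain m where m: "(1/3) ^ m < 2 * r"
      "Metric_space.mball \<nat> geo_dist x (2 * r) = {y \<in> \<nat>. real m \<le> y}"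
      using mball_geo_tail[OF assms(1)] by metis
    \<comment> \<open>Since 2 < 3, doubling the radius moves the start of the tail back by at most
      one point, which costs a factor of at most 3.\<close>
    have "n \<le> Suc m" using m(1) assms by (intro n(1)) simp
    then have "(1/3 :: real) ^ Suc m \<le> (1/3) ^ n" by (intro power_decreasing) auto
    then show ?thesis
      unfolding n(2) m(2) emeasure_geo_atLeast
      by (simp flip: ennreal_mult del: ennreal_numeral)
  qed
qed

text \<open>Every point is isolated, so all subsets are open and Borel regularity holds with B =
  A.\<close>

lemma doubling_metric_measure_space_geo:
  "doubling_metric_measure_space \<nat> geo_dist geo_measure"
proof -
  interpret Metric_space \<nat> geo_dist by (rule Metric_space_geo)
  have openin: "openin mtopology A" if "A \<subseteq> \<nat>" for A
    unfolding openin_mtopology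
  proof (intro conjI that allI impI)
    fix x assume "x \<in> A"
    then show "\<exists>r>0. mball x r \<subseteq> A"
      using that mball_geo_small[of x "geo_weight x"] geo_weight_pos[of x]
      by (intro exI[of _ "geo_weight x"]) auto
  qed
  show ?thesis
  proof
    show "sigma_sets \<nat> {U. openin mtopology U} \<subseteq> sets geo_measure"
      using sigma_sets_into_sp[of "{U. openin mtopology U}" \<nat>] openin_subset[of mtopology]
      by auto
  next
    fix A assume "A \<in> sets geo_measure"
    then show "\<exists>B\<in>sigma_sets \<nat> {U. openin mtopology U}.
        A \<subseteq> B \<and> emeasure geo_measure B = emeasure geo_measure A"
      using openin by (intro bexI[of _ A] sigma_sets.Basic) auto
  next
    fix x r :: real assume x: "x \<in> \<nat>" "0 < r"
    then obtain k where k: "x = real k" by (auto elim: Nats_cases)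
    have "0 < emeasure geo_measure {real k}" by (simp add: emeasure_geo_singleton)
    also have "\<dots> \<le> emeasure geo_measure (mball x r)"
      using x k by (intro emeasure_mono) (auto simp: subset_iff)
    finally show "0 < emeasure geo_measure (mball x r)" .
    show "emeasure geo_measure (mball x r) < \<infinity>"
      by (simp flip: less_top)
  next
    show "\<exists>c::real. 1 \<le> c \<and> (\<forall>x\<in>\<nat>. \<forall>r>0.
        emeasure geo_measure (mball x (2 * r)) \<le> ennreal c * emeasure geo_measure (mball x r))"
      using geo_doubling by (intro exI[of _ 3]) auto
  qed simp
qed

section \<open>Exponential decay implies weak \<open>L\<^sup>\<infinity>\<close>\<close>

lemma decr_rearrangement_antimono:
  "s \<le> t \<Longrightarrow> decr_rearrangement \<mu> f t \<le> decr_rearrangement \<mu> f s"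
  unfolding decr_rearrangement_def
  by (intro Inf_superset_mono) (blast intro: order_trans ennreal_leI)

text \<open>If the level l is admissible in the infimum for t, then by decay l + b is admissible for
  t / 4. The infimum is approached up to a slack e.\<close>

lemma decr_rearrangement_quarter:
  assumes decay: "\<And>l. 0 \<le> l \<Longrightarrow> 4 * distribution_fun \<mu> f (l + b) \<le> distribution_fun \<mu> f l"
    and "0 \<le> b" "0 < t"
  shows "decr_rearrangement \<mu> f (t / 4) \<le> decr_rearrangement \<mu> f t + ennreal b"
proof (rule ennreal_le_epsilon)
  fix e :: real
  assume fin: "decr_rearrangement \<mu> f t + ennreal b < top" and e: "0 < e"
  then have "decr_rearrangement \<mu> f t < decr_rearrangement \<mu> f t + ennreal e"
    by (cases "decr_rearrangement \<mu> f t") (auto simp: ennreal_less_iff simp flip: ennreal_plus)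
  then obtain l where l: "0 \<le> l" "distribution_fun \<mu> f l \<le> ennreal t"
    "ennreal l < decr_rearrangement \<mu> f t + ennreal e"
    by (subst (asm) decr_rearrangement_def) (auto simp: Inf_less_iff)
  have "4 * distribution_fun \<mu> f (l + b) \<le> ennreal (4 * (t / 4))"
    using decay[OF l(1)] l(2) by (simp add: order_trans)
  then have "4 * distribution_fun \<mu> f (l + b) \<le> 4 * ennreal (t / 4)"
    using \<open>0 < t\<close> by (subst (asm) ennreal_mult) auto
  then have "distribution_fun \<mu> f (l + b) \<le> ennreal (t / 4)"
    by (subst (asm) ennreal_mult_le_mult_iff) auto
  then have "decr_rearrangement \<mu> f (t / 4) \<le> ennreal (l + b)"
    unfolding decr_rearrangement_def using l(1) assms(2)
    by (intro Inf_lower CollectI exI[of _ "l + b"]) auto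
  also have "\<dots> = ennreal l + ennreal b" using l(1) assms(2) by simp
  also have "\<dots> \<le> (decr_rearrangement \<mu> f t + ennreal e) + ennreal b"
    using l(3) by (intro add_right_mono less_imp_le)
  finally show "decr_rearrangement \<mu> f (t / 4) \<le> decr_rearrangement \<mu> f t + ennreal b + ennreal e"
    by (simp add: ac_simps)
qed

lemma decr_rearrangement_quarter_power:
  assumes decay: "\<And>l. 0 \<le> l \<Longrightarrow> 4 * distribution_fun \<mu> f (l + b) \<le> distribution_fun \<mu> f l"
    and "0 \<le> b" "0 < t"
  shows "decr_rearrangement \<mu> f (t / 4 ^ k) \<le> decr_rearrangement \<mu> f t + ennreal (real k * b)"
proof (induction k)
  case (Suc k)
  have "decr_rearrangement \<mu> f (t / 4 ^ Suc k) = decr_rearrangement \<mu> f (t / 4 ^ k / 4)"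
    by (simp add: field_simps)
  also have "\<dots> \<le> decr_rearrangement \<mu> f (t / 4 ^ k) + ennreal b"
    using assms by (intro decr_rearrangement_quarter) auto
  also have "\<dots> \<le> decr_rearrangement \<mu> f t + ennreal (real k * b) + ennreal b"
    by (intro add_right_mono Suc.IH)
  also have "\<dots> = decr_rearrangement \<mu> f t + ennreal (real (Suc k) * b)"
    using assms(2) by (simp add: add.assoc algebra_simps flip: ennreal_plus)
  finally show ?case .
qed simp

text \<open>About log_4 (t / s) quarterings lead from t to s, each costing b. Bounding this number k
  by 2^k = 2 * 2^(k - 1) <= 2 * sqrt (t / s) replaces the logarithm by a power that is integrable at
  0.\<close>

lemma decr_rearrangement_le_powr:
  assumes decay: "\<And>l. 0 \<le> l \<Longrightarrow> 4 * distribution_fun \<mu> f (l + b) \<le> distribution_fun \<mu> f l"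
    and "0 \<le> b" "0 < s" "s < t"
  shows "decr_rearrangement \<mu> f s
    \<le> decr_rearrangement \<mu> f t + ennreal (2 * b * t powr (1/2) * s powr (-1/2))"
proof -
  define k where "k = (LEAST k. t / s \<le> 4 ^ k)"
  obtain j where "t / s < 4 ^ j" using real_arch_pow[of 4 "t / s"] by auto
  then have k: "t / s \<le> 4 ^ k" unfolding k_def by (rule LeastI[OF less_imp_le])
  have "k \<noteq> 0" using k assms by (intro notI) (simp add: field_simps)
  then obtain i where i: "k = Suc i" by (cases k) auto
  \<comment> \<open>Minimality of k, used one step earlier, bounds 4^(k - 1) by t / s.\<close>
  have "\<not> t / s \<le> 4 ^ i" by (rule not_less_Least) (simp add: k_def[symmetric] i)
  then have "(4 ^ i) powr (1/2) \<le> (t / s) powr (1/2)"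
    by (intro powr_mono2) auto
  moreover have "(4 ^ i :: real) powr (1/2) = 2 ^ i"
    by (simp add: powr_half_sqrt real_sqrt_power)
  ultimately have "2 ^ i \<le> (t / s) powr (1/2)" by simp
  moreover have "(t / s) powr (1/2) = t powr (1/2) * s powr (-1/2)"
    using assms by (simp add: powr_divide powr_minus_divide)
  moreover have "real k \<le> 2 * 2 ^ i"
  proof -
    have "k \<le> 2 ^ k" by (rule less_imp_le) (rule less_exp)
    then have "real k \<le> real (2 ^ k)" by (rule of_nat_mono)
    then show ?thesis by (simp add: i)
  qed
  ultimately have "real k * b \<le> 2 * (t powr (1/2) * s powr (-1/2)) * b"
    using \<open>0 \<le> b\<close> by (intro mult_right_mono) auto
  moreover have "decr_rearrangement \<mu> f s \<le> decr_rearrangement \<mu> f (t / 4 ^ k)"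
    using k assms by (intro decr_rearrangement_antimono) (simp add: field_simps)
  moreover have "decr_rearrangement \<mu> f (t / 4 ^ k)
      \<le> decr_rearrangement \<mu> f t + ennreal (real k * b)"
    using assms by (intro decr_rearrangement_quarter_power[OF decay]) auto
  ultimately show ?thesis
    by (auto intro!: add_left_mono ennreal_leI elim!: order_trans simp: ac_simps)
qed

lemma nn_integral_powr_minus_half:
  assumes "0 < t"
  shows "(\<integral>\<^sup>+s\<in>{0<..<t}. ennreal (s powr (-1/2)) \<partial>lborel) = ennreal (2 * t powr (1/2))"
proof -
  have "((\<lambda>s. s powr (-1/2)) has_integral (t powr (-1/2 + 1) / (-1/2 + 1))) {0..t}"
    using assms by (intro has_integral_powr_from_0) auto
  then have "((\<lambda>s. s powr (-1/2)) has_integral (2 * t powr (1/2))) {0<..<t}"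
    by (subst has_integral_open_interval[of _ _ 0 t, simplified]) (simp add: mult.commute)
  then show ?thesis
    by (intro nn_integral_has_integral_lebesgue') auto
qed

text \<open>Integrating the power bound over (0, t) adds 2 * b * sqrt t times 2 * sqrt t to t times
  the value at t. Division by t leaves an excess of 4 * b, independent of t.\<close>

lemma weak_LinftyI_exponential_decay:
  assumes meas: "f \<in> borel_measurable \<mu>"
    and decay: "\<And>l. 0 \<le> l \<Longrightarrow> 4 * distribution_fun \<mu> f (l + b) \<le> distribution_fun \<mu> f l"
    and "0 \<le> b"
    and fin: "\<And>t. 0 < t \<Longrightarrow> decr_rearrangement \<mu> f t < \<infinity>"
  shows "f \<in> weak_Linfty \<mu>"
proof -
  have bound: "maximal_rearrangement \<mu> f t - decr_rearrangement \<mu> f t \<le> ennreal (4 * b)"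
    if t: "0 < t" for t
  proof -
    define D where "D = decr_rearrangement \<mu> f t"
    have "(\<integral>\<^sup>+s\<in>{0<..<t}. decr_rearrangement \<mu> f s \<partial>lborel)
        \<le> (\<integral>\<^sup>+s. D * indicator {0<..<t} s + ennreal (2 * b * t powr (1/2)) *
              (ennreal (s powr (-1/2)) * indicator {0<..<t} s) \<partial>lborel)"
      using decr_rearrangement_le_powr[OF decay \<open>0 \<le> b\<close>] \<open>0 \<le> b\<close>
      by (intro nn_integral_mono) (auto simp: D_def indicator_def simp flip: ennreal_mult)
    also have "\<dots> = D * ennreal t + ennreal (2 * b * t powr (1/2)) * ennreal (2 * t powr (1/2))"
      using t by (subst nn_integral_add)
        (auto simp: nn_integral_cmult nn_integral_cmult_indicator nn_integral_powr_minus_half[simplified])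
    also have "ennreal (2 * b * t powr (1/2)) * ennreal (2 * t powr (1/2)) = ennreal (4 * b) * ennreal t"
      using t \<open>0 \<le> b\<close> by (simp add: powr_half_sqrt flip: ennreal_mult)
    finally have "(\<integral>\<^sup>+s\<in>{0<..<t}. decr_rearrangement \<mu> f s \<partial>lborel) \<le> (D + ennreal (4 * b)) * ennreal t"
      by (simp add: distrib_right)
    then have "maximal_rearrangement \<mu> f t \<le> (D + ennreal (4 * b)) * ennreal t / ennreal t"
      unfolding maximal_rearrangement_def by (rule divide_right_mono_ennreal)
    also have "\<dots> = D + ennreal (4 * b)"
      using t by (intro ennreal_mult_divide_eq) auto
    \<comment> \<open>In \<open>ennreal\<close>, \<open>top - top\<close> is \<open>top\<close>;
      finiteness of \<open>D\<close> excludes this case.\<close>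
    finally show ?thesis
      using fin[OF t] by (auto simp: D_def ennreal_minus_le_iff)
  qed
  have "(SUP t\<in>{0<..}. maximal_rearrangement \<mu> f t - decr_rearrangement \<mu> f t) \<le> ennreal (4 * b)"
    by (intro SUP_least bound) auto
  then have "(SUP t\<in>{0<..}. maximal_rearrangement \<mu> f t - decr_rearrangement \<mu> f t) < \<infinity>"
    by (rule le_less_trans) simp
  with meas fin show ?thesis by (simp add: weak_Linfty_def)
qed

section \<open>The function lies in weak \<open>L\<^sup>\<infinity>\<close>\<close>

lemma even_part_of_nat: "even_part (real n) = (if even n then real n else 0)"
  by (simp add: even_part_def)

text \<open>As l is nonnegative, the zeros at odd points never exceed it, so only even points above
  l count.\<close>

lemma distribution_even_part_le:
  assumes "\<And>m. l < real m \<Longrightarrow> even m \<Longrightarrow> n \<le> m" "0 \<le> l"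
  shows "distribution_fun geo_measure even_part l \<le> ennreal (3/2 * (1/3) ^ n)"
proof -
  have "{x \<in> space geo_measure. \<bar>even_part x\<bar> > l} \<subseteq> {y \<in> \<nat>. real n \<le> y}"
    using assms by (auto elim!: Nats_cases simp: even_part_of_nat split: if_splits)
  then show ?thesis
    unfolding distribution_fun_def emeasure_geo_atLeast[symmetric]
    by (intro emeasure_mono) auto
qed

lemma distribution_even_part_ge:
  assumes "l < real n" "even n"
  shows "ennreal ((1/3) ^ n) \<le> distribution_fun geo_measure even_part l"
  unfolding distribution_fun_def emeasure_geo_singleton[symmetric]
  using assms by (intro emeasure_mono) (auto simp: even_part_of_nat)

text \<open>The shift 2 is the spacing of the even numbers: it moves the first even point above the
  level from n to n + 2. Four times the tail from there is 2/3 * (1/3)^n, below the mass of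
  n.\<close>

lemma distribution_even_part_decay:
  assumes "0 \<le> l"
  shows "4 * distribution_fun geo_measure even_part (l + 2) \<le> distribution_fun geo_measure even_part l"
proof -
  define n where "n = (LEAST m. l < real m \<and> even m)"
  obtain j where "l < real j" using reals_Archimedean2 by blast
  then have "l < real (2 * j) \<and> even (2 * j)" by simp
  then have n: "l < real n \<and> even n" unfolding n_def by (rule LeastI)
  have least: "n \<le> m" if "l < real m" "even m" for m
    unfolding n_def using that by (intro Least_le) simp
  have "n + 2 \<le> m" if "l + 2 < real m" "even m" for m
    using least[of "m - 2"] that \<open>0 \<le> l\<close> by (cases "2 \<le> m") (auto simp: of_nat_diff)
  then have "4 * distribution_fun geo_measure even_part (l + 2) \<le> 4 * ennreal (3/2 * (1/3) ^ (n + 2))"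
    using \<open>0 \<le> l\<close> by (intro mult_left_mono distribution_even_part_le) auto
  also have "\<dots> \<le> ennreal ((1/3) ^ n)"
    by (subst ennreal_numeral[symmetric]) (simp flip: ennreal_mult del: ennreal_numeral)
  also have "\<dots> \<le> distribution_fun geo_measure even_part l"
    using n by (intro distribution_even_part_ge) auto
  finally show ?thesis .
qed

lemma even_part_weak_Linfty: "even_part \<in> weak_Linfty geo_measure"
proof (rule weak_LinftyI_exponential_decay)
  show "even_part \<in> borel_measurable geo_measure"
    by (rule borel_measurable_geo_measure)
  show "4 * distribution_fun geo_measure even_part (l + 2) \<le> distribution_fun geo_measure even_part l"
    if "0 \<le> l" for l using that by (rule distribution_even_part_decay)
  show "decr_rearrangement geo_measure even_part t < \<infinity>" if t: "0 < t" for t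
  proof -
    \<comment> \<open>The factor 2/3 brings the tail mass 3/2 * (1/3)^n below t, so the level n is
      admissible.\<close>
    obtain n where n: "(1/3) ^ n < 2/3 * t"
      using real_arch_pow_inv[of "2/3 * t" "1/3"] t by auto
    have "distribution_fun geo_measure even_part (real n) \<le> ennreal (3/2 * (1/3) ^ n)"
      by (rule distribution_even_part_le) auto
    also have "\<dots> \<le> ennreal t" using n by (intro ennreal_leI) simp
    finally have "decr_rearrangement geo_measure even_part t \<le> ennreal (real n)"
      unfolding decr_rearrangement_def by (intro Inf_lower) auto
    then show ?thesis by (rule le_less_trans) simp
  qed
qed simp

section \<open>Equimeasurable functions and unbounded oscillation\<close>

lemma equimeasurable_geo_abs_eq:
  assumes "equimeasurable geo_measure f g" "x \<in> \<nat>"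
  shows "\<bar>g x\<bar> = \<bar>f x\<bar>"
proof -
  have "{y \<in> \<nat>. \<bar>f y\<bar> > l} = {y \<in> \<nat>. \<bar>g y\<bar> > l}" if "0 \<le> l" for l
    using assms(1) that
    by (intro emeasure_geo_inj) (auto simp: equimeasurable_def distribution_fun_def)
  then have "\<bar>f x\<bar> > l \<longleftrightarrow> \<bar>g x\<bar> > l" if "0 \<le> l" for l
    using assms(2) that by blast
  \<comment> \<open>No number exceeds itself, so these two levels give both inequalities.\<close>
  from this[of "\<bar>f x\<bar>"] this[of "\<bar>g x\<bar>"] show ?thesis by auto
qed

text \<open>The points n and n + 1 carry 2/3 and 2/9 of the mass of the tail. By the triangle
  inequality through c, the smaller share times the jump bounds the mean deviation. As c is
  arbitrary, it can be the average of g.\<close>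

lemma oscillation_geo_ge:
  assumes "set_integrable geo_measure {y \<in> \<nat>. real n \<le> y} g"
  shows "2/9 * \<bar>g (real n) - g (real (Suc n))\<bar>
    \<le> set_average geo_measure {y \<in> \<nat>. real n \<le> y} (\<lambda>y. \<bar>g y - c\<bar>)"
proof -
  define B where "B = {y \<in> \<nat>. real n \<le> y}"
  have "set_integrable geo_measure B (\<lambda>y. \<bar>g y - c\<bar>)"
    unfolding B_def using assms
    by (intro set_integrable_abs set_integral_diff) (auto simp: set_integrable_def simp flip: less_top)
  then have int: "integrable geo_measure (\<lambda>y. indicator B y *\<^sub>R \<bar>g y - c\<bar>)"
    by (simp add: set_integrable_def)
  \<comment> \<open>The deviation restricted to the two points, a lower bound for the integrand on
    B.\<close>
  let ?h = "\<lambda>y. indicator {real n} y * \<bar>g (real n) - c\<bar> + indicator {real (Suc n)} y * \<bar>g (real (Suc n)) - c\<bar>"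
  have "(1/3) ^ Suc n * \<bar>g (real n) - g (real (Suc n))\<bar>
      \<le> (1/3) ^ Suc n * (\<bar>g (real n) - c\<bar> + \<bar>g (real (Suc n)) - c\<bar>)"
    by (intro mult_left_mono) auto
  also have "\<dots> \<le> (1/3) ^ n * \<bar>g (real n) - c\<bar> + (1/3) ^ Suc n * \<bar>g (real (Suc n)) - c\<bar>"
    by (simp add: distrib_left mult_right_mono)
  also have "\<dots> = (LINT y|geo_measure. ?h y)"
    by (subst Bochner_Integration.integral_add)
      (auto simp: measure_geo_singleton measure_geo_singleton[of "Suc n", simplified]
        simp flip: less_top)
  also have "\<dots> \<le> (LINT y:B|geo_measure. \<bar>g y - c\<bar>)"
    unfolding set_lebesgue_integral_def
  proof (rule integral_mono[OF _ int])
    show "integrable geo_measure ?h"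
      by (intro Bochner_Integration.integrable_add integrable_mult_left) (auto simp flip: less_top)
  qed (auto simp: B_def indicator_def)
  finally have "(1/3) ^ Suc n * \<bar>g (real n) - g (real (Suc n))\<bar> / (3/2 * (1/3) ^ n)
      \<le> (LINT y:B|geo_measure. \<bar>g y - c\<bar>) / (3/2 * (1/3) ^ n)"
    by (intro divide_right_mono) auto
  then show ?thesis
    unfolding set_average_def B_def[symmetric]
    by (simp add: B_def measure_geo_atLeast)
qed

text \<open>The unknown signs of g do not matter: at an even n the jump to the zero at n + 1 has
  size n.\<close>

lemma not_BMO_if_abs_eq_even_part:
  assumes "\<And>x. x \<in> \<nat> \<Longrightarrow> \<bar>g x\<bar> = \<bar>even_part x\<bar>"
  shows "g \<notin> BMO \<nat> geo_dist geo_measure"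
proof
  assume "g \<in> BMO \<nat> geo_dist geo_measure"
  then obtain M where int: "\<And>x r. x \<in> \<nat> \<Longrightarrow> 0 < r \<Longrightarrow>
      set_integrable geo_measure (Metric_space.mball \<nat> geo_dist x r) g"
    and M: "\<And>x r. x \<in> \<nat> \<Longrightarrow> 0 < r \<Longrightarrow> set_average geo_measure (Metric_space.mball \<nat> geo_dist x r)
      (\<lambda>y. \<bar>g y - set_average geo_measure (Metric_space.mball \<nat> geo_dist x r) g\<bar>) \<le> M"
    by (auto simp: BMO_def Let_def) blast
  \<comment> \<open>For n = 2 * k the oscillation is at least 2/9 * n = 4/9 * k, which exceeds
    M.\<close>
  obtain k where k: "9/4 * M < real k" using reals_Archimedean2 by blast
  define n where "n = 2 * k"
  \<comment> \<open>The radius lies strictly between (1/3)^n and 3 * (1/3)^n, so the ball is the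
    tail that starts exactly at n.\<close>
  have "geo_weight (real n) < 2 * (1/3) ^ n" by simp
  then obtain m where m: "(1/3) ^ m < 2 * (1/3 :: real) ^ n"
    "\<And>i. (1/3) ^ i < 2 * (1/3 :: real) ^ n \<Longrightarrow> m \<le> i"
    "Metric_space.mball \<nat> geo_dist (real n) (2 * (1/3) ^ n) = {y \<in> \<nat>. real m \<le> y}"
    by (rule mball_geo_tail[OF of_nat_in_Nats]) (rule that)
  have "m = n"
  proof (rule antisym)
    show "m \<le> n" by (rule m(2)) simp
    show "n \<le> m"
    proof (rule ccontr)
      assume "\<not> n \<le> m"
      then have "(1/3 :: real) ^ n \<le> (1/3) ^ Suc m" by (intro power_decreasing) auto
      moreover have "(0 :: real) < (1/3) ^ m" by simp
      ultimately show False using m(1) by simp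
    qed
  qed
  note ball = m(3)[unfolded this]
  have "2/9 * \<bar>g (real n) - g (real (Suc n))\<bar> \<le> M"
    using M[of "real n" "2 * (1/3) ^ n"] int[of "real n" "2 * (1/3) ^ n"] unfolding ball
    by (intro order_trans[OF oscillation_geo_ge]) auto
  moreover have "\<bar>g (real n)\<bar> = real n" "\<bar>g (real (Suc n))\<bar> = 0"
    using assms[of "real n"] assms[of "real (Suc n)"] even_part_of_nat[of n] even_part_of_nat[of "Suc n"]
    by (auto simp: n_def)
  ultimately show False using k by (auto simp: n_def)
qed

theorem lemma4p7:
  "\<exists>(X :: real set) (d :: real \<Rightarrow> real \<Rightarrow> real) (\<mu> :: real measure) (f :: real \<Rightarrow> real).
    doubling_metric_measure_space X d \<mu> \<and>
    f \<in> weak_Linfty \<mu> \<and>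
    (\<forall>g :: real \<Rightarrow> real. equimeasurable \<mu> f g \<longrightarrow> g \<notin> BMO X d \<mu>)"
  using doubling_metric_measure_space_geo even_part_weak_Linfty
    not_BMO_if_abs_eq_even_part equimeasurable_geo_abs_eq
  by blast

end
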